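(* There exist a planar graph $G$ and a signature $\sigma: E(G)\to\{1,-1\}$ such that the signed graph $(G,\sigma)$ is not $4$-choosable, but the unsigned graph $G$ is $4$-choosable.
   Context: All graphs are finite and simple. A signed graph is a pair $(G,\sigma)$ where $G$ is a graph and $\sigma: E(G)\to\{1,-1\}$ is a mapping, called a signature of $G$. A proper coloring of $(G,\sigma)$ is a map $c: V(G)\to\mathbb{Z}$ such that $c(u)\neq \sigma(uv)\,c(v)$ for every edge $uv\in E(G)$. A list-assignment is a function $L$ on $V(G)$ with $\emptyset\neq L(v)\subseteq\mathbb{Z}$ for each $v\in V(G)$; it is a $k$-list-assignment if $|L(v)|=k$ for every $v\in V(G)$. An $L$-coloring is a proper coloring $c$ of $(G,\sigma)$ with $c(v)\in L(v)$ for every $v\in V(G)$. $(G,\sigma)$ is $k$-choosable if it has an $L$-coloring for every $k$-list-assignment $L$. The unsigned graph $G$ is $k$-choosable in the usual sense, i.e. for every $k$-list-assignment $L$ there is a map $c$ with $c(v)\in L(v)$ for all $v$ and $c(u)\ne c(v)$ for every edge $uv$ (equivalently, the signed graph with all edges of sign $1$ is $k$-choosable). *)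

theory Defs
  imports "HOL-Analysis.Analysis"
begin

definition simple_graph :: "'a set \<Rightarrow> 'a set set \<Rightarrow> bool" where
  "simple_graph V E \<longleftrightarrow> finite V \<and> (\<forall>e\<in>E. e \<subseteq> V \<and> card e = 2)"

definition plane_drawing ::
  "'a set \<Rightarrow> 'a set set \<Rightarrow> ('a \<Rightarrow> real \<times> real) \<Rightarrow> ('a set \<Rightarrow> real \<Rightarrow> real \<times> real) \<Rightarrow> bool" where
  "plane_drawing V E p \<gamma> \<longleftrightarrow>
     inj_on p V \<and>
     (\<forall>e\<in>E. arc (\<gamma> e) \<and> {pathstart (\<gamma> e), pathfinish (\<gamma> e)} = p ` e) \<and>
     (\<forall>e\<in>E. path_image (\<gamma> e) \<inter> p ` V \<subseteq> p ` e) \<and>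
     (\<forall>e\<in>E. \<forall>f\<in>E. e \<noteq> f \<longrightarrow> path_image (\<gamma> e) \<inter> path_image (\<gamma> f) \<subseteq> p ` (e \<inter> f))"

definition planar_graph :: "'a set \<Rightarrow> 'a set set \<Rightarrow> bool" where
  "planar_graph V E \<longleftrightarrow> simple_graph V E \<and> (\<exists>p \<gamma>. plane_drawing V E p \<gamma>)"

definition signature :: "'a set set \<Rightarrow> ('a set \<Rightarrow> int) \<Rightarrow> bool" where
  "signature E \<sigma> \<longleftrightarrow> (\<forall>e\<in>E. \<sigma> e \<in> {1, -1})"

definition signed_proper_coloring :: "'a set set \<Rightarrow> ('a set \<Rightarrow> int) \<Rightarrow> ('a \<Rightarrow> int) \<Rightarrow> bool" where
  "signed_proper_coloring E \<sigma> c \<longleftrightarrow> (\<forall>u v. {u, v} \<in> E \<longrightarrow> c u \<noteq> \<sigma> {u, v} * c v)"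

definition proper_coloring :: "'a set set \<Rightarrow> ('a \<Rightarrow> int) \<Rightarrow> bool" where
  "proper_coloring E c \<longleftrightarrow> (\<forall>u v. {u, v} \<in> E \<longrightarrow> c u \<noteq> c v)"

definition list_assignment :: "'a set \<Rightarrow> ('a \<Rightarrow> int set) \<Rightarrow> bool" where
  "list_assignment V L \<longleftrightarrow> (\<forall>v\<in>V. L v \<noteq> {})"

definition k_list_assignment :: "nat \<Rightarrow> 'a set \<Rightarrow> ('a \<Rightarrow> int set) \<Rightarrow> bool" where
  "k_list_assignment k V L \<longleftrightarrow>
     list_assignment V L \<and> (\<forall>v\<in>V. finite (L v) \<and> card (L v) = k)"

definition signed_choosable :: "nat \<Rightarrow> 'a set \<Rightarrow> 'a set set \<Rightarrow> ('a set \<Rightarrow> int) \<Rightarrow> bool" where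
  "signed_choosable k V E \<sigma> \<longleftrightarrow>
     (\<forall>L. k_list_assignment k V L \<longrightarrow>
        (\<exists>c. signed_proper_coloring E \<sigma> c \<and> (\<forall>v\<in>V. c v \<in> L v)))"

definition choosable :: "nat \<Rightarrow> 'a set \<Rightarrow> 'a set set \<Rightarrow> bool" where
  "choosable k V E \<longleftrightarrow>
     (\<forall>L. k_list_assignment k V L \<longrightarrow>
        (\<exists>c. proper_coloring E c \<and> (\<forall>v\<in>V. c v \<in> L v)))"

end

theory Submission
  imports Defs
begin

text \<open>
  Even cycles are 2-choosable, but a 4-cycle with exactly one negative edge has no proper signed
  coloring from the lists \<open>{t, -t}\<close>. Hence a 4-cycle placed inside a face of length four, each of
  its vertices being joined to two consecutive vertices of the face, extends every coloring of the
  face in the unsigned setting, whereas in the signed setting suitable lists exclude any prescribed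
  coloring of the face.

  The gadget has two terminals \<open>x = 0\<close> and \<open>y = 1\<close>. The vertices 2, 3, 4, 5 are joined to both
  terminals, and 2-3 and 5-4 are edges. Inside each of the triangles 0-2-3 and 0-5-4 sits a
  triangle that can rule out one coloring of the edge 2-3 (resp. 5-4), but never all of them.
  With suitable lists the colors of 3 and 4 are thus forced once \<open>x\<close> and \<open>y\<close> are colored, and the
  signed 4-cycle 12-13-14-15 inside the face 0-3-1-4 excludes the resulting coloring. Sixteen copies
  glued at \<open>x\<close> and \<open>y\<close> exclude all the sixteen ways to color the terminals from two disjoint lists.
\<close>

section \<open>List coloring of small graphs\<close>

text \<open>Take two colors from each list. If the four pairs agree, alternate. Otherwise some two
  neighbors have different pairs: give one of them a color missing from the other's pair, and go
  round the cycle so that this other vertex comes last.\<close>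

lemma four_cycle_two_choosable:
  fixes A B C D :: "'c set"
  assumes "2 \<le> card A" "2 \<le> card B" "2 \<le> card C" "2 \<le> card D"
  obtains a b c d where "a \<in> A" "b \<in> B" "c \<in> C" "d \<in> D" "a \<noteq> b" "b \<noteq> c" "c \<noteq> d" "d \<noteq> a"
proof -
  have two: "\<exists>p q. p \<in> S \<and> q \<in> S \<and> p \<noteq> q" if "2 \<le> card S" for S :: "'c set"
    using that card_le_Suc0_iff_eq[of S]
    by (metis Suc_1 card.infinite not_less_eq_eq numeral_2_eq_2 le_zero_eq zero_neq_numeral)
  obtain a1 a2 b1 b2 c1 c2 d1 d2 where
    "a1 \<in> A" "a2 \<in> A" "a1 \<noteq> a2" "b1 \<in> B" "b2 \<in> B" "b1 \<noteq> b2"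
    "c1 \<in> C" "c2 \<in> C" "c1 \<noteq> c2" "d1 \<in> D" "d2 \<in> D" "d1 \<noteq> d2"
    using two assms by metis
  then show thesis using that by metis
qed

lemma card_Diff_singleton_ge:
  assumes "Suc n \<le> card S"
  shows "n \<le> card (S - {x})"
  using assms diff_card_le_card_Diff[of "{x}" S] by auto

lemma ex_in_Diff_pair:
  assumes "3 \<le> card S"
  obtains s where "s \<in> S" "s \<noteq> x" "s \<noteq> y"
proof -
  have "1 \<le> card (S - {x} - {y})"
    using assms by (intro card_Diff_singleton_ge) simp
  then have "S - {x} - {y} \<noteq> {}" by (metis card.empty not_one_le_zero)
  then show thesis using that by blast
qed

text \<open>This is the wheel left after coloring the terminals: the rim edge with lists
  \<open>A\<close>, \<open>B\<close> has lost up to two colors per list, the rest of the rim up to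
  one, and the hub list \<open>H\<close> is intact.\<close>

lemma four_wheel_list_coloring:
  fixes A B C D H :: "'c set"
  assumes A: "2 \<le> card A" and B: "2 \<le> card B" and C: "3 \<le> card C" and D: "3 \<le> card D"
    and H: "4 \<le> card H"
  obtains a b c d h where "a \<in> A" "b \<in> B" "c \<in> C" "d \<in> D" "h \<in> H"
    "a \<noteq> b" "b \<noteq> c" "c \<noteq> d" "d \<noteq> a" "h \<noteq> a" "h \<noteq> b" "h \<noteq> c" "h \<noteq> d"
proof -
  \<comment> \<open>With exactly two colors in each of \<open>A'\<close> and \<open>B'\<close>, a
    hub list inside their union must equal it, and all four colors are then distinct.\<close>
  obtain A' where A': "A' \<subseteq> A" "card A' = 2" by (metis A obtain_subset_with_card_n)
  obtain B' where B': "B' \<subseteq> B" "card B' = 2" by (metis B obtain_subset_with_card_n)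
  obtain p q where pq: "A' = {p, q}" "p \<noteq> q" using A' by (metis card_2_iff)
  obtain r s where rs: "B' = {r, s}" "r \<noteq> s" using B' by (metis card_2_iff)
  show thesis
  proof (cases "H \<subseteq> {p, q, r, s}")
    case False
    \<comment> \<open>Such a hub color costs only \<open>C\<close> and \<open>D\<close> a color, so
      every rim list keeps two.\<close>
    then obtain h where h: "h \<in> H" "h \<notin> A'" "h \<notin> B'" using pq rs by auto
    have "2 \<le> card (C - {h})" "2 \<le> card (D - {h})"
      using C D by (auto intro: card_Diff_singleton_ge)
    then obtain a b c d where "a \<in> A'" "b \<in> B'" "c \<in> C - {h}" "d \<in> D - {h}"
      "a \<noteq> b" "b \<noteq> c" "c \<noteq> d" "d \<noteq> a"
      using four_cycle_two_choosable[of A' B' "C - {h}" "D - {h}"] A' B' by (metis order_refl)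
    with h A' B' show thesis using that[of a b c d h] by auto
  next
    case True
    have "card {p, q, r, s} \<le> 4" by (simp add: card_insert_if)
    then have Heq: "H = {p, q, r, s}" using H True
      by (meson card_seteq finite.emptyI finite.insertI order_trans)
    have dis: "p \<noteq> r" "p \<noteq> s" "q \<noteq> r" "q \<noteq> s"
      using H Heq by (auto simp: card_insert_if split: if_splits)
    have inA: "q \<in> A" and inB: "r \<in> B" "s \<in> B" and inH: "p \<in> H"
      using A' B' pq rs Heq by auto
    obtain m where m: "m \<in> D" "m \<noteq> p" "m \<noteq> q" using ex_in_Diff_pair[OF D] .
    \<comment> \<open>With the hub colored \<open>p\<close>, the color \<open>n\<close> below clashes with at most one of \<open>r\<close> and \<open>s\<close>.\<close>
    obtain n where n: "n \<in> C" "n \<noteq> p" "n \<noteq> m" using ex_in_Diff_pair[OF C] .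
    show thesis
    proof (cases "n = r")
      case True
      then show thesis using that[of q s n m p] inA inB inH m n dis pq rs by auto
    next
      case False
      then show thesis using that[of q r n m p] inA inB inH m n dis pq rs by auto
    qed
  qed
qed

section \<open>The gadget\<close>

text \<open>A terminal occurs only as the first entry of a pair, so the second endpoint of every
  edge is an inner vertex. The terminals are not adjacent.\<close>

definition gadget_edges :: "(nat \<times> nat) list" where
  "gadget_edges =
    [(0,2),(0,3),(0,4),(0,5),(1,2),(1,3),(1,4),(1,5),(2,3),(5,4),
     (0,6),(2,6),(2,7),(3,7),(3,8),(0,8),(6,7),(7,8),(6,8),
     (0,9),(5,9),(5,10),(4,10),(4,11),(0,11),(9,10),(10,11),(9,11),
     (0,12),(3,12),(3,13),(1,13),(1,14),(4,14),(4,15),(0,15),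
     (12,13),(13,14),(14,15),(12,15)]"

lemma gadget_edges_lt_16:
  assumes "(i, j) \<in> set gadget_edges"
  shows "i < 16" "j < 16" "i \<noteq> j" "2 \<le> j"
  using assms by (auto simp: gadget_edges_def)

lemma all_lt_16:
  "(\<forall>i<16. Q i) \<longleftrightarrow> Q (0::nat) \<and> Q 1 \<and> Q 2 \<and> Q 3 \<and> Q 4 \<and> Q 5 \<and> Q 6 \<and> Q 7 \<and> Q 8 \<and> Q 9 \<and>
     Q 10 \<and> Q 11 \<and> Q 12 \<and> Q 13 \<and> Q 14 \<and> Q 15"
  by (simp add: numeral_eq_Suc All_less_Suc2)

text \<open>Once the terminals are colored, the vertices 2, 3, 8, 6 with hub 7 and 5, 4, 11, 9 with
  hub 10 form two wheels to be colored independently. Each vertex of the cycle 12-13-14-15 then sees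
  two colored vertices and keeps two colors. The case \<open>a = b\<close> is included.\<close>

lemma gadget_precoloring_extends:
  fixes M :: "nat \<Rightarrow> 'c set"
  assumes M: "\<And>i. i < 16 \<Longrightarrow> card (M i) = 4" and a: "a \<in> M 0" and b: "b \<in> M 1"
  obtains c where "c 0 = a" "c 1 = b" "\<And>i. i < 16 \<Longrightarrow> c i \<in> M i"
    "\<And>i j. (i, j) \<in> set gadget_edges \<Longrightarrow> c i \<noteq> c j"
proof -
  have D1: "3 \<le> card (M i - {z})" if "i < 16" for i z
    using M[OF that] by (auto intro: card_Diff_singleton_ge)
  have D2: "2 \<le> card (M i - {z} - {z'})" if "i < 16" for i z z'
    using D1[OF that, of z] by (auto intro: card_Diff_singleton_ge)
  have M4: "4 \<le> card (M i)" if "i < 16" for i using M[OF that] by simp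
  obtain c2 c3 c8 c6 c7 where top:
    "c2 \<in> M 2 - {a} - {b}" "c3 \<in> M 3 - {a} - {b}" "c8 \<in> M 8 - {a}" "c6 \<in> M 6 - {a}" "c7 \<in> M 7"
    "c2 \<noteq> c3" "c3 \<noteq> c8" "c8 \<noteq> c6" "c6 \<noteq> c2" "c7 \<noteq> c2" "c7 \<noteq> c3" "c7 \<noteq> c8" "c7 \<noteq> c6"
    by (rule four_wheel_list_coloring[of "M 2 - {a} - {b}" "M 3 - {a} - {b}" "M 8 - {a}"
          "M 6 - {a}" "M 7"]) (simp_all add: D1 D2 M4)
  obtain c5 c4 c11 c9 c10 where bot:
    "c5 \<in> M 5 - {a} - {b}" "c4 \<in> M 4 - {a} - {b}" "c11 \<in> M 11 - {a}" "c9 \<in> M 9 - {a}"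
    "c10 \<in> M 10"
    "c5 \<noteq> c4" "c4 \<noteq> c11" "c11 \<noteq> c9" "c9 \<noteq> c5" "c10 \<noteq> c5" "c10 \<noteq> c4" "c10 \<noteq> c11" "c10 \<noteq> c9"
    by (rule four_wheel_list_coloring[of "M 5 - {a} - {b}" "M 4 - {a} - {b}" "M 11 - {a}"
          "M 9 - {a}" "M 10"]) (simp_all add: D1 D2 M4)
  obtain c12 c13 c14 c15 where mid:
    "c12 \<in> M 12 - {a} - {c3}" "c13 \<in> M 13 - {c3} - {b}" "c14 \<in> M 14 - {b} - {c4}"
    "c15 \<in> M 15 - {c4} - {a}"
    "c12 \<noteq> c13" "c13 \<noteq> c14" "c14 \<noteq> c15" "c15 \<noteq> c12"
    by (rule four_cycle_two_choosable[of "M 12 - {a} - {c3}" "M 13 - {c3} - {b}"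
          "M 14 - {b} - {c4}" "M 15 - {c4} - {a}"]) (simp_all add: D2)
  define c where "c = (!) [a, b, c2, c3, c4, c5, c6, c7, c8, c9, c10, c11, c12, c13, c14, c15]"
  have c: "c 0 = a" "c 1 = b" "c 2 = c2" "c 3 = c3" "c 4 = c4" "c 5 = c5" "c 6 = c6" "c 7 = c7"
    "c 8 = c8" "c 9 = c9" "c 10 = c10" "c 11 = c11" "c 12 = c12" "c 13 = c13" "c 14 = c14"
    "c 15 = c15"
    by (simp_all add: c_def)
  have "\<forall>i<16. c i \<in> M i"
    unfolding all_lt_16 c using a b top bot mid by simp
  moreover have "\<forall>(i, j)\<in>set gadget_edges. c i \<noteq> c j"
    unfolding gadget_edges_def using top bot mid by (auto simp: c c[unfolded One_nat_def])
  ultimately show thesis using that[of c] c by blast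
qed

section \<open>Signature and lists that exclude a given coloring of the terminals\<close>

definition gadget_sign :: "nat \<Rightarrow> nat \<Rightarrow> int" where
  "gadget_sign i j = (if {i, j} = {12, 15} then -1 else 1)"

text \<open>Terminal colors \<open>a\<close> and \<open>b\<close> reduce the lists of 2, 3, 4, 5 to
  {9, 10}. The triangles 6-7-8 and 9-10-11 are left with {11, 12} exactly when 3, respectively 4,
  gets color 10. If 3 and 4 both get 9, the inner cycle is left with {11, -11}.\<close>

definition gadget_list :: "int \<Rightarrow> int \<Rightarrow> nat \<Rightarrow> int set" where
  "gadget_list a b = (!)
    [{1,2,3,4}, {5,6,7,8},
     {a,b,9,10}, {a,b,9,10}, {a,b,9,10}, {a,b,9,10},
     {a,9,11,12}, {9,10,11,12}, {10,a,11,12},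
     {a,9,11,12}, {9,10,11,12}, {10,a,11,12},
     {a,9,11,-11}, {9,b,11,-11}, {b,9,11,-11}, {9,a,11,-11}]"

lemma card_gadget_list:
  assumes "a \<in> {1,2,3,4}" "b \<in> {5,6,7,8}" "i < 16"
  shows "card (gadget_list a b i) = 4"
proof -
  have "\<forall>i<16. card (gadget_list a b i) = 4"
    unfolding all_lt_16 gadget_list_def using assms(1,2) by (simp add: card_insert_if) auto
  then show ?thesis using assms(3) by simp
qed

lemma gadget_no_signed_coloring:
  fixes c :: "nat \<Rightarrow> int"
  assumes a: "c 0 \<in> {1,2,3,4}" and b: "c 1 \<in> {5,6,7,8}"
    and L: "\<And>i. i < 16 \<Longrightarrow> c i \<in> gadget_list (c 0) (c 1) i"
    and E: "\<And>i j. (i, j) \<in> set gadget_edges \<Longrightarrow> c i \<noteq> gadget_sign i j * c j"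
  shows False
proof -
  have "\<forall>i<16. c i \<in> gadget_list (c 0) (c 1) i" using L by blast
  note L' = this[unfolded all_lt_16]
  have L2: "c 2 \<in> {c 0, c 1, 9, 10}" "c 3 \<in> {c 0, c 1, 9, 10}" "c 4 \<in> {c 0, c 1, 9, 10}"
    "c 5 \<in> {c 0, c 1, 9, 10}" "c 6 \<in> {c 0, 9, 11, 12}" "c 7 \<in> {9, 10, 11, 12}"
    "c 8 \<in> {10, c 0, 11, 12}" "c 9 \<in> {c 0, 9, 11, 12}" "c 10 \<in> {9, 10, 11, 12}"
    "c 11 \<in> {10, c 0, 11, 12}" "c 12 \<in> {c 0, 9, 11, -11}" "c 13 \<in> {9, c 1, 11, -11}"
    "c 14 \<in> {c 1, 9, 11, -11}" "c 15 \<in> {9, c 0, 11, -11}"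
    using L' by (simp_all add: gadget_list_def)
  have E': "\<forall>(i, j)\<in>set gadget_edges. c i \<noteq> gadget_sign i j * c j" using E by blast
  have E2: "c 0 \<noteq> c 2" "c 0 \<noteq> c 3" "c 0 \<noteq> c 4" "c 0 \<noteq> c 5" "c 1 \<noteq> c 2" "c 1 \<noteq> c 3" "c 1 \<noteq> c 4"
    "c 1 \<noteq> c 5" "c 2 \<noteq> c 3" "c 5 \<noteq> c 4" "c 0 \<noteq> c 6" "c 2 \<noteq> c 6" "c 2 \<noteq> c 7" "c 3 \<noteq> c 7"
    "c 3 \<noteq> c 8" "c 0 \<noteq> c 8" "c 6 \<noteq> c 7" "c 7 \<noteq> c 8" "c 6 \<noteq> c 8" "c 0 \<noteq> c 9" "c 5 \<noteq> c 9"
    "c 5 \<noteq> c 10" "c 4 \<noteq> c 10" "c 4 \<noteq> c 11" "c 0 \<noteq> c 11" "c 9 \<noteq> c 10" "c 10 \<noteq> c 11"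
    "c 9 \<noteq> c 11" "c 0 \<noteq> c 12" "c 3 \<noteq> c 12" "c 3 \<noteq> c 13" "c 1 \<noteq> c 13" "c 1 \<noteq> c 14"
    "c 4 \<noteq> c 14" "c 4 \<noteq> c 15" "c 0 \<noteq> c 15" "c 12 \<noteq> c 13" "c 13 \<noteq> c 14" "c 14 \<noteq> c 15"
    "c 12 \<noteq> - c 15"
    using E' by (simp_all add: gadget_edges_def gadget_sign_def doubleton_eq_iff)
  have "c 3 = 9"
  proof (rule ccontr)
    assume "c 3 \<noteq> 9"
    then have "c 3 = 10" "c 2 = 9" using L2(1,2) E2 by auto
    then have "c 6 \<in> {11, 12}" "c 7 \<in> {11, 12}" "c 8 \<in> {11, 12}" using L2(5-7) E2 by auto
    \<comment> \<open>A triangle cannot be colored with the two colors 11 and 12.\<close>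
    then show False using E2(17-19) by auto
  qed
  moreover have "c 4 = 9"
  proof (rule ccontr)
    assume "c 4 \<noteq> 9"
    then have "c 4 = 10" "c 5 = 9" using L2(3,4) E2 by auto
    then have "c 9 \<in> {11, 12}" "c 10 \<in> {11, 12}" "c 11 \<in> {11, 12}" using L2(8-10) E2 by auto
    then show False using E2(26-28) by auto
  qed
  ultimately have "c 12 \<in> {11, -11}" "c 13 \<in> {11, -11}" "c 14 \<in> {11, -11}" "c 15 \<in> {11, -11}"
    using L2(11-14) E2(29-36) by auto
  \<comment> \<open>The three positive edges each flip the sign, so \<open>c 15 = - c 12\<close>,
    which the negative edge 12-15 forbids.\<close>
  then show False using E2(37-40) by auto
qed

section \<open>Drawing the gadget\<close>

definition gadget_pos :: "nat \<Rightarrow> int \<times> int" where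
  "gadget_pos = (!)
    [(-12,0), (12,0), (0,12), (1,4), (1,-4), (0,-12), (-5,6), (-1,6), (-3,4),
     (-5,-6), (-1,-6), (-3,-4), (-2,1), (2,1), (2,-1), (-2,-1)]"

definition gadget_point :: "nat \<Rightarrow> real \<times> real" where
  "gadget_point i = (case gadget_pos i of (u, v) \<Rightarrow> (of_int u, of_int v))"

text \<open>Twice the signed area of a triangle. Being polymorphic, it can be evaluated on the
  integer coordinates and transferred to the real points.\<close>

fun orient :: "'a::ring \<times> 'a \<Rightarrow> 'a \<times> 'a \<Rightarrow> 'a \<times> 'a \<Rightarrow> 'a" where
  "orient (a1, a2) (b1, b2) (c1, c2) = (b1 - a1) * (c2 - a2) - (b2 - a2) * (c1 - a1)"

lemma orient_gadget_point:
  "orient (gadget_point i) (gadget_point j) (gadget_point k) =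
     of_int (orient (gadget_pos i) (gadget_pos j) (gadget_pos k))"
  by (simp add: gadget_point_def split: prod.split)

section \<open>Separating segments by orientation signs\<close>

lemma orient_affine:
  fixes A :: "real \<times> real"
  shows "orient A B ((1 - t) *\<^sub>R C + t *\<^sub>R D) = (1 - t) * orient A B C + t * orient A B D"
  by (cases A; cases B; cases C; cases D) (simp add: algebra_simps)

lemma orient_endpoints [simp]:
  fixes A :: "real \<times> real"
  shows "orient A B A = 0" "orient A B B = 0"
  by (cases A; cases B; simp)+

lemma orient_on_segment:
  fixes A :: "real \<times> real"
  assumes "Q \<in> closed_segment A B"
  shows "orient A B Q = 0"
  using assms by (auto simp: in_segment orient_affine)

text \<open>Both \<open>C\<close> and \<open>D\<close> lie strictly on the same side of the line
  \<open>A B\<close>. Along \<open>C D\<close> the orientation is a convex combination of two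
  numbers of the same strict sign, hence never zero, whereas it vanishes on
  \<open>A B\<close>.\<close>

lemma closed_segments_disjoint:
  fixes A :: "real \<times> real"
  assumes "orient A B C * orient A B D > 0"
  shows "closed_segment A B \<inter> closed_segment C D = {}"
proof (rule ccontr)
  assume "\<not> ?thesis"
  then obtain Q where "Q \<in> closed_segment A B" "Q \<in> closed_segment C D" by blast
  then obtain t where t: "0 \<le> t" "t \<le> 1" "(1 - t) * orient A B C + t * orient A B D = 0"
    using orient_on_segment[of Q A B] by (auto simp: in_segment orient_affine)
  define u v where "u = orient A B C" and "v = orient A B D"
  have "u * v > 0" using assms by (simp add: u_def v_def)
  then consider "u > 0" "v > 0" | "u < 0" "v < 0" by (auto simp: zero_less_mult_iff)
  then show False
  proof cases
    case 1
    then have "(1 - t) * u + t * v > 0" using t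
      by (cases "t = 0") (auto intro: add_nonneg_pos)
    then show False using t by (simp add: u_def v_def)
  next
    case 2
    then have "(1 - t) * u \<le> 0" "t * v \<le> 0" "t \<noteq> 0 \<Longrightarrow> t * v < 0" using t
      by (simp_all add: mult_nonneg_nonpos mult_pos_neg)
    then have "(1 - t) * u + t * v < 0" using 2 by (cases "t = 0") auto
    then show False using t by (simp add: u_def v_def)
  qed
qed

lemma closed_segments_common_endpoint:
  fixes A :: "real \<times> real"
  assumes "orient A B D \<noteq> 0"
  shows "closed_segment A B \<inter> closed_segment A D \<subseteq> {A}"
proof
  fix Q assume "Q \<in> closed_segment A B \<inter> closed_segment A D"
  then obtain t where t: "Q = (1 - t) *\<^sub>R A + t *\<^sub>R D" "orient A B Q = 0"
    using orient_on_segment[of Q A B] by (auto simp: in_segment)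
  then have "t * orient A B D = 0" by (simp add: orient_affine)
  then show "Q \<in> {A}" using assms t by simp
qed

text \<open>A sufficient criterion in integers: distinct edges with a common endpoint are not
  collinear, and for two edges without one, some edge lies strictly on one side of the line through
  the other. The disjunct \<open>j = n\<close> admits an edge paired with itself.\<close>

fun gadget_cross_free :: "nat \<times> nat \<Rightarrow> nat \<times> nat \<Rightarrow> bool" where
  "gadget_cross_free (i, j) (m, n) \<longleftrightarrow>
     (let or = (\<lambda>u v w. orient (gadget_pos u) (gadget_pos v) (gadget_pos w)) in
      if i = m then j = n \<or> or i j n \<noteq> 0
      else if i = n then or i j m \<noteq> 0
      else if j = m then or j i n \<noteq> 0
      else if j = n then or j i m \<noteq> 0
      else or i j m * or i j n > 0 \<or> or m n i * or m n j > 0)"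

lemma gadget_edges_cross_free:
  "list_all (\<lambda>e. list_all (gadget_cross_free e) gadget_edges) gadget_edges"
  by code_simp

lemma gadget_segments_inter:
  assumes e: "(i, j) \<in> set gadget_edges" and f: "(m, n) \<in> set gadget_edges"
    and ne: "{i, j} \<noteq> {m, n}"
  shows "closed_segment (gadget_point i) (gadget_point j) \<inter>
         closed_segment (gadget_point m) (gadget_point n) \<subseteq> gadget_point ` ({i, j} \<inter> {m, n})"
proof -
  let ?P = gadget_point
  have free: "gadget_cross_free (i, j) (m, n)"
    using gadget_edges_cross_free e f unfolding list_all_iff by blast
  have share: "closed_segment (?P z) (?P v) \<inter> closed_segment (?P z) (?P w) \<subseteq> ?P ` {z}"
    if "orient (gadget_pos z) (gadget_pos v) (gadget_pos w) \<noteq> 0" for z v w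
    using closed_segments_common_endpoint[of "?P z" "?P v" "?P w"] that
    by (simp add: orient_gadget_point)
  have disj: "closed_segment (?P u) (?P v) \<inter> closed_segment (?P w) (?P z) = {}"
    if "orient (gadget_pos u) (gadget_pos v) (gadget_pos w) *
        orient (gadget_pos u) (gadget_pos v) (gadget_pos z) > 0" for u v w z
    using closed_segments_disjoint[of "?P u" "?P v" "?P w" "?P z"] that
    by (simp add: orient_gadget_point flip: of_int_mult)
  consider "i = m" | "i \<noteq> m" "i = n" | "i \<noteq> m" "i \<noteq> n" "j = m"
    | "i \<noteq> m" "i \<noteq> n" "j \<noteq> m" "j = n" | "i \<noteq> m" "i \<noteq> n" "j \<noteq> m" "j \<noteq> n" by blast
  then show ?thesis
  proof cases
    case 1
    then show ?thesis using share[of i j n] free ne by auto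
  next
    case 2
    then show ?thesis using share[of i j m] free by (auto simp: closed_segment_commute)
  next
    case 3
    then show ?thesis using share[of j i n] free by (auto simp: closed_segment_commute)
  next
    case 4
    then show ?thesis using share[of j i m] free by (auto simp: closed_segment_commute)
  next
    case 5
    then show ?thesis using disj[of i j m n] disj[of m n i j] free by auto
  qed
qed

lemma gadget_point_eq_iff:
  assumes "i < 16" "j < 16"
  shows "gadget_point i = gadget_point j \<longleftrightarrow> i = j"
proof -
  have "\<forall>i<16. \<forall>j<16. gadget_pos i = gadget_pos j \<longrightarrow> i = j"
    unfolding all_lt_16 by (simp add: gadget_pos_def)
  then show ?thesis using assms by (auto simp: gadget_point_def split: prod.splits)
qed

lemma gadget_edge_at_vertex:
  assumes "z < 16"
  obtains i j where "(i, j) \<in> set gadget_edges" "z \<in> {i, j}"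
proof -
  have "\<forall>z<16. \<exists>(i, j)\<in>set gadget_edges. z \<in> {i, j}"
    unfolding all_lt_16 gadget_edges_def by simp
  then show thesis using assms that by blast
qed

text \<open>No separate computation is required: \<open>z\<close> is an endpoint of some edge, so if
  it lay on another edge avoiding it, the two edges would meet outside their common
  endpoints.\<close>

lemma gadget_vertex_on_edge:
  assumes e: "(i, j) \<in> set gadget_edges" and z: "z < 16"
    and mem: "gadget_point z \<in> closed_segment (gadget_point i) (gadget_point j)"
  shows "z \<in> {i, j}"
proof (rule ccontr)
  assume z': "z \<notin> {i, j}"
  obtain m n where f: "(m, n) \<in> set gadget_edges" "z \<in> {m, n}"
    using gadget_edge_at_vertex[OF z] .
  then have "gadget_point z \<in> closed_segment (gadget_point m) (gadget_point n)" by auto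
  then have "gadget_point z \<in> gadget_point ` ({i, j} \<inter> {m, n})"
    using gadget_segments_inter[OF e f(1)] mem f(2) z' by blast
  then obtain w where "w \<in> {i, j}" "gadget_point z = gadget_point w" by blast
  then show False using z z' gadget_edges_lt_16[OF e] by (auto simp: gadget_point_eq_iff)
qed

text \<open>The rhombus has corners (-12, 0), (12, 0), (0, 18), (0, -18). Inner vertices are
  strictly inside and terminals are corners. By convexity of the norm \<open>N\<close>, a segment
  whose second endpoint is inside can touch the boundary only at its first endpoint.\<close>

lemma gadget_segment_in_rhombus:
  assumes e: "(i, j) \<in> set gadget_edges"
    and mem: "(X, Y) \<in> closed_segment (gadget_point i) (gadget_point j)"
  shows "2 * \<bar>Y\<bar> + 3 * \<bar>X\<bar> < 36 \<or> (X, Y) \<in> {gadget_point 0, gadget_point 1}"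
proof -
  define N where "N = (\<lambda>(x, y). 2 * \<bar>y\<bar> + 3 * \<bar>x\<bar> :: real)"
  have convex: "N ((1 - t) *\<^sub>R A + t *\<^sub>R B) \<le> (1 - t) * N A + t * N B"
    if "0 \<le> t" "t \<le> 1" for t A B
  proof -
    have *: "\<bar>(1 - t) * r + t * s\<bar> \<le> (1 - t) * \<bar>r\<bar> + t * \<bar>s\<bar>" for r s
      using that abs_triangle_ineq[of "(1 - t) * r" "t * s"] by (simp add: abs_mult)
    obtain a1 a2 b1 b2 where AB: "A = (a1, a2)" "B = (b1, b2)" by fastforce
    show ?thesis unfolding AB N_def using *[of a1 b1] *[of a2 b2] by (simp add: algebra_simps)
  qed
  have "\<forall>i<16. 2 \<le> i \<longrightarrow> N (gadget_point i) < 36"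
    unfolding all_lt_16 by (simp add: N_def gadget_point_def gadget_pos_def)
  then have lt: "N (gadget_point i) < 36" if "i < 16" "2 \<le> i" for i using that by blast
  have "N (gadget_point 0) = 36" "N (gadget_point 1) = 36"
    by (simp_all add: N_def gadget_point_def gadget_pos_def)
  then have le: "N (gadget_point i) \<le> 36"
    using lt[of i] gadget_edges_lt_16[OF e]
    by (metis less_2_cases less_imp_le linorder_not_le order_refl One_nat_def)
  have terminal: "gadget_point i \<in> {gadget_point 0, gadget_point 1}" if "\<not> N (gadget_point i) < 36"
    using lt[of i] gadget_edges_lt_16[OF e] that
    by (metis One_nat_def insertCI less_2_cases linorder_not_le)
  have ltj: "N (gadget_point j) < 36" using lt gadget_edges_lt_16[OF e] by blast
  obtain t where t: "0 \<le> t" "t \<le> 1"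
    and XY: "(X, Y) = (1 - t) *\<^sub>R gadget_point i + t *\<^sub>R gadget_point j"
    using mem by (auto simp: in_segment)
  show ?thesis
  proof (cases "t = 0")
    case True
    then have "(X, Y) = gadget_point i" using XY by simp
    then show ?thesis using terminal by (metis N_def case_prod_conv)
  next
    case False
    have "(1 - t) * N (gadget_point i) \<le> (1 - t) * 36" using le t by (intro mult_left_mono) auto
    \<comment> \<open>Strictness comes from here, since \<open>t > 0\<close> and the second endpoint
      is never a terminal.\<close>
    moreover have "t * N (gadget_point j) < t * 36" using ltj t False by simp
    moreover have "N (X, Y) \<le> (1 - t) * N (gadget_point i) + t * N (gadget_point j)"
      unfolding XY by (rule convex[OF t])
    ultimately have "N (X, Y) < 36" by argo
    then show ?thesis by (simp add: N_def)
  qed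
qed

section \<open>Gluing sixteen copies\<close>

definition copy :: "nat \<Rightarrow> nat \<Rightarrow> nat" where
  "copy k i = (if i < 2 then i else 14 * k + i)"

text \<open>Copy \<open>k\<close> owns the numbers 14k + 2 to 14k + 15. Truncated subtraction
  assigns both terminals to copy 0, which is harmless because positions, lists and colors of
  terminals are the same for every copy.\<close>

definition copy_index :: "nat \<Rightarrow> nat" where
  "copy_index v = (v - 2) div 14"

definition base_vertex :: "nat \<Rightarrow> nat" where
  "base_vertex v = (if v < 2 then v else (v - 2) mod 14 + 2)"

lemma base_vertex_copy [simp]:
  assumes "i < 16"
  shows "base_vertex (copy k i) = i"
proof (cases "i < 2")
  case False
  then obtain d where "i = 2 + d" by (metis le_iff_add not_less)
  then show ?thesis using assms by (simp add: base_vertex_def copy_def)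
qed (simp add: base_vertex_def copy_def)

lemma copy_index_copy:
  assumes "i < 16" "2 \<le> i"
  shows "copy_index (copy k i) = k"
proof -
  obtain d where "i = 2 + d" using assms(2) by (metis le_iff_add)
  then show ?thesis using assms by (simp add: copy_index_def copy_def)
qed

lemma copy_eq_iff: "i < 16 \<Longrightarrow> j < 16 \<Longrightarrow> copy k i = copy k j \<longleftrightarrow> i = j"
  by (metis base_vertex_copy)

definition glued_vertices :: "nat set" where
  "glued_vertices = {copy k i | k i. k < 16 \<and> i < 16}"

definition glued_edges :: "nat set set" where
  "glued_edges = {{copy k i, copy k j} | k i j. k < 16 \<and> (i, j) \<in> set gadget_edges}"

definition glued_signature :: "nat set \<Rightarrow> int" where
  "glued_signature e = (if base_vertex ` e = {12, 15} then -1 else 1)"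

lemma glued_signature_copy:
  assumes "i < 16" "j < 16"
  shows "glued_signature {copy k i, copy k j} = gadget_sign i j"
  using assms by (simp add: glued_signature_def gadget_sign_def)

lemma simple_graph_glued: "simple_graph glued_vertices glued_edges"
proof -
  have "glued_vertices = (\<lambda>(k, i). copy k i) ` ({..<16} \<times> {..<16})"
    by (auto simp: glued_vertices_def)
  then have "finite glued_vertices"
    by (metis finite_SigmaI finite_imageI finite_lessThan)
  moreover have "e \<subseteq> glued_vertices \<and> card e = 2" if "e \<in> glued_edges" for e
  proof -
    obtain k i j where e: "e = {copy k i, copy k j}" "k < 16" "(i, j) \<in> set gadget_edges"
      using \<open>e \<in> glued_edges\<close> unfolding glued_edges_def by blast
    note ij = gadget_edges_lt_16[OF e(3)]
    then have "copy k i \<noteq> copy k j" by (simp add: copy_eq_iff)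
    then show ?thesis using e ij by (auto simp: glued_vertices_def)
  qed
  ultimately show ?thesis by (simp add: simple_graph_def)
qed

subsection \<open>Planarity\<close>

text \<open>
  The maps \<open>shift k\<close> are homeomorphisms of the plane that fix both terminals and send the rhombus
  containing the gadget to rhombus-like regions which, for different \<open>k\<close>, meet only in the terminals.
\<close>

definition shift :: "nat \<Rightarrow> real \<times> real \<Rightarrow> real \<times> real" where
  "shift k = (\<lambda>(x, y). (x, y + real k * (36 - 3 * \<bar>x\<bar>)))"

lemma inj_shift: "inj (shift k)"
  by (auto simp: inj_def shift_def)

lemma continuous_on_shift: "continuous_on S (shift k)"
  unfolding shift_def case_prod_unfold by (intro continuous_intros)

lemma shift_terminal: "i < 2 \<Longrightarrow> shift k (gadget_point i) = gadget_point i"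
  using less_2_cases[of i] by (auto simp: shift_def gadget_point_def gadget_pos_def)

text \<open>At abscissa x the open rhombus has vertical width 36 - 3|x|, and \<open>shift k\<close>
  moves it by \<open>k\<close> times exactly this width. The sections for different indices are
  therefore disjoint wherever the width is positive, which leaves only the terminals.\<close>

lemma shift_eq_terminal:
  assumes "(i, j) \<in> set gadget_edges" "A \<in> closed_segment (gadget_point i) (gadget_point j)"
    and "(m, n) \<in> set gadget_edges" "B \<in> closed_segment (gadget_point m) (gadget_point n)"
    and eq: "shift k A = shift l B" and "k \<noteq> l"
  shows "\<exists>z<2. A = gadget_point z \<and> B = gadget_point z"
proof -
  obtain X Y X' Y' where AB: "A = (X, Y)" "B = (X', Y')" by fastforce
  have X: "X' = X" and Y: "Y + real k * (36 - 3 * \<bar>X\<bar>) = Y' + real l * (36 - 3 * \<bar>X\<bar>)"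
    using eq by (auto simp: AB shift_def)
  have bA: "2 * \<bar>Y\<bar> + 3 * \<bar>X\<bar> < 36 \<or> (X, Y) \<in> {gadget_point 0, gadget_point 1}"
    and bB: "2 * \<bar>Y'\<bar> + 3 * \<bar>X\<bar> < 36 \<or> (X, Y') \<in> {gadget_point 0, gadget_point 1}"
    using gadget_segment_in_rhombus assms(1-4) unfolding AB X by blast+
  have terminals: "gadget_point 0 = (-12, 0)" "gadget_point 1 = (12, 0)"
    by (simp_all add: gadget_point_def gadget_pos_def)
  have "\<not> 3 * \<bar>X\<bar> < 36"
  proof
    assume lt: "3 * \<bar>X\<bar> < 36"
    then have "2 * \<bar>Y\<bar> < 36 - 3 * \<bar>X\<bar>" "2 * \<bar>Y'\<bar> < 36 - 3 * \<bar>X\<bar>"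
      using bA bB by (auto simp: terminals terminals[unfolded One_nat_def])
    moreover have "36 - 3 * \<bar>X\<bar> \<le> \<bar>real k - real l\<bar> * (36 - 3 * \<bar>X\<bar>)"
    proof -
      have "1 \<le> \<bar>real k - real l\<bar>" using \<open>k \<noteq> l\<close> by linarith
      then show ?thesis using mult_right_mono[of 1 "\<bar>real k - real l\<bar>" "36 - 3 * \<bar>X\<bar>"] lt by simp
    qed
    moreover have "\<bar>real k - real l\<bar> * (36 - 3 * \<bar>X\<bar>) = \<bar>Y' - Y\<bar>"
    proof -
      have "(real k - real l) * (36 - 3 * \<bar>X\<bar>) = Y' - Y" using Y by (simp add: left_diff_distrib)
      then show ?thesis using lt by (metis abs_mult abs_of_pos diff_gt_0_iff_gt)
    qed
    ultimately show False by linarith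
  qed
  then have "(X, Y) \<in> {gadget_point 0, gadget_point 1}" "(X, Y') \<in> {gadget_point 0, gadget_point 1}"
    using bA bB by auto
  then have "A = B" "A = gadget_point 0 \<or> A = gadget_point 1"
    by (auto simp: AB X terminals terminals[unfolded One_nat_def])
  then show ?thesis by (metis one_less_numeral_iff pos2 semiring_norm(76))
qed

lemma planar_graph_glued: "planar_graph glued_vertices glued_edges"
proof -
  define p where "p v = shift (copy_index v) (gadget_point (base_vertex v))" for v
  define seg where "seg i j = closed_segment (gadget_point i) (gadget_point j)" for i j
  have p_copy: "p (copy k i) = shift k (gadget_point i)" if "i < 16" for k i
    using that shift_terminal[of i] by (cases "i < 2") (auto simp: p_def copy_index_copy)
  have "\<forall>e\<in>glued_edges. \<exists>g. \<exists>k i j. k < 16 \<and> (i, j) \<in> set gadget_edges \<and>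
      e = {copy k i, copy k j} \<and> g = shift k \<circ> linepath (gadget_point i) (gadget_point j)"
    unfolding glued_edges_def by blast
  from bchoice[OF this] obtain \<gamma> where \<gamma>: "\<And>e. e \<in> glued_edges \<Longrightarrow> \<exists>k i j. k < 16 \<and>
      (i, j) \<in> set gadget_edges \<and> e = {copy k i, copy k j} \<and>
      \<gamma> e = shift k \<circ> linepath (gadget_point i) (gadget_point j)"
    by blast
  have img: "path_image (shift k \<circ> linepath (gadget_point i) (gadget_point j)) = shift k ` seg i j"
    for k i j by (simp add: path_image_compose seg_def)
  have inter: "shift k ` seg i j \<inter> shift l ` seg m n \<subseteq>
      p ` ({copy k i, copy k j} \<inter> {copy l m, copy l n})"
    if e: "(i, j) \<in> set gadget_edges" and f: "(m, n) \<in> set gadget_edges"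
      and ne: "{copy k i, copy k j} \<noteq> {copy l m, copy l n}" for i j k l m n
  proof
    fix q assume "q \<in> shift k ` seg i j \<inter> shift l ` seg m n"
    then obtain A B where A: "A \<in> seg i j" "q = shift k A" and B: "B \<in> seg m n" "q = shift l B"
      by blast
    note lt = gadget_edges_lt_16[OF e] gadget_edges_lt_16[OF f]
    show "q \<in> p ` ({copy k i, copy k j} \<inter> {copy l m, copy l n})"
    proof (cases "k = l")
      case True
      then have "A = B" using A B inj_shift[of k] by (auto dest: injD)
      moreover have "{i, j} \<noteq> {m, n}" using ne True by auto
      ultimately obtain z where z: "z \<in> {i, j}" "z \<in> {m, n}" "A = gadget_point z"
        using gadget_segments_inter[OF e f] A(1) B(1) unfolding seg_def by blast
      then have "q = p (copy k z)" using A(2) lt by (auto simp: p_copy)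
      then show ?thesis using z True by blast
    next
      case False
      then obtain z where z: "z < 2" "A = gadget_point z" "B = gadget_point z"
        using shift_eq_terminal[of i j A m n B k l] e f A B unfolding seg_def by auto
      \<comment> \<open>A terminal lying on an edge is one of its endpoints, so the meeting point is
        a common vertex of the two glued edges.\<close>
      then have "z \<in> {i, j}" "z \<in> {m, n}"
        using gadget_vertex_on_edge[OF e, of z] gadget_vertex_on_edge[OF f, of z] A(1) B(1)
        unfolding seg_def by auto
      moreover have "copy k z = copy l z" using z(1) by (simp add: copy_def)
      moreover have "q = p (copy k z)" using A(2) z by (simp add: p_copy)
      ultimately show ?thesis by blast
    qed
  qed
  have inj: "inj_on p glued_vertices"
  proof (rule inj_onI)
    fix v w assume "v \<in> glued_vertices" "w \<in> glued_vertices" and eq: "p v = p w"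
    then obtain k i l j where v: "v = copy k i" "i < 16" and w: "w = copy l j" "j < 16"
      by (auto simp: glued_vertices_def)
    have eq': "shift k (gadget_point i) = shift l (gadget_point j)"
      using eq v w by (simp add: p_copy)
    show "v = w"
    proof (cases "k = l")
      case True
      then show ?thesis using eq' inj_shift[of k] v w by (auto dest!: injD simp: gadget_point_eq_iff)
    next
      case False
      \<comment> \<open>Every vertex lies on an edge, so the separation of segments from different
        copies applies to vertices too.\<close>
      obtain i1 i2 j1 j2 where 1: "(i1, i2) \<in> set gadget_edges" "i \<in> {i1, i2}"
        and 2: "(j1, j2) \<in> set gadget_edges" "j \<in> {j1, j2}"
        by (metis gadget_edge_at_vertex v(2) w(2))
      then obtain z where "z < 2" "gadget_point i = gadget_point z" "gadget_point j = gadget_point z"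
        using shift_eq_terminal[OF 1(1) _ 2(1) _ eq' False] by auto
      then have "i = z" "j = z" "z < 2" using v w by (auto simp: gadget_point_eq_iff)
      then show ?thesis using v w by (simp add: copy_def)
    qed
  qed
  have cross: "path_image (\<gamma> e) \<inter> path_image (\<gamma> f) \<subseteq> p ` (e \<inter> f)"
    if "e \<in> glued_edges" "f \<in> glued_edges" "e \<noteq> f" for e f
    using \<gamma>[OF that(1)] \<gamma>[OF that(2)] that(3) inter by (elim exE conjE) (simp add: img)
  have arc: "arc (\<gamma> e) \<and> {pathstart (\<gamma> e), pathfinish (\<gamma> e)} = p ` e" if "e \<in> glued_edges" for e
  proof -
    obtain k i j where e: "(i, j) \<in> set gadget_edges" "e = {copy k i, copy k j}"
      "\<gamma> e = shift k \<circ> linepath (gadget_point i) (gadget_point j)"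
      using \<gamma>[OF \<open>e \<in> glued_edges\<close>] by blast
    note ij = gadget_edges_lt_16[OF e(1)]
    have "arc (linepath (gadget_point i) (gadget_point j))"
      using ij by (simp add: gadget_point_eq_iff)
    then have "arc (\<gamma> e)" unfolding e(3) arc_def
      by (auto intro!: path_continuous_image continuous_on_shift comp_inj_on
          intro: inj_on_subset[OF inj_shift])
    then show ?thesis using ij unfolding e(3)
      by (simp add: e(2) pathstart_compose pathfinish_compose p_copy)
  qed
  have on_vertex: "path_image (\<gamma> e) \<inter> p ` glued_vertices \<subseteq> p ` e" if e: "e \<in> glued_edges" for e
  proof
    fix q assume q: "q \<in> path_image (\<gamma> e) \<inter> p ` glued_vertices"
    then obtain k z where z: "k < 16" "z < 16" "q = p (copy k z)"
      by (auto simp: glued_vertices_def)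
    obtain i j where ij: "(i, j) \<in> set gadget_edges" "z \<in> {i, j}"
      by (metis gadget_edge_at_vertex z(2))
    \<comment> \<open>The vertex is an endpoint of the drawn edge \<open>f\<close>, which reduces
      the claim to the intersection of \<open>e\<close> and \<open>f\<close>.\<close>
    define f where "f = {copy k i, copy k j}"
    have f: "f \<in> glued_edges" "copy k z \<in> f" using ij z by (auto simp: f_def glued_edges_def)
    have "q \<in> p ` f" using f z by blast
    then have "q \<in> {pathstart (\<gamma> f), pathfinish (\<gamma> f)}" using arc[OF f(1)] by blast
    then have "q \<in> path_image (\<gamma> f)" by auto
    then show "q \<in> p ` e" using cross[OF e f(1)] q \<open>q \<in> p ` f\<close> by (cases "e = f") auto
  qed
  have "plane_drawing glued_vertices glued_edges p \<gamma>"
    unfolding plane_drawing_def using inj arc on_vertex cross by blast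
  then show ?thesis unfolding planar_graph_def using simple_graph_glued by blast
qed

subsection \<open>Choosability\<close>

text \<open>Distinct copies share only the terminals. Fix colors there from their lists and extend
  to each copy independently.\<close>

lemma choosable_glued: "choosable 4 glued_vertices glued_edges"
  unfolding choosable_def
proof (intro allI impI)
  fix L assume "k_list_assignment 4 glued_vertices L"
  then have L: "card (L (copy k i)) = 4" if "k < 16" "i < 16" for k i
    using that unfolding k_list_assignment_def glued_vertices_def by blast
  have terms: "copy k 0 = 0" "copy k 1 = 1" for k by (simp_all add: copy_def)
  have "card (L 0) = 4" "card (L 1) = 4" using L[of 0 0] L[of 0 1] terms by simp_all
  then obtain a b where a: "a \<in> L 0" and b: "b \<in> L 1"
    by (metis card.empty ex_in_conv zero_neq_numeral)
  have "\<exists>c. c 0 = a \<and> c 1 = b \<and> (\<forall>i<16. c i \<in> L (copy k i)) \<and>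
      (\<forall>(i, j)\<in>set gadget_edges. c i \<noteq> c j)" if "k < 16" for k
    by (rule gadget_precoloring_extends[of "\<lambda>i. L (copy k i)" a b])
      (use L[OF that] a b terms in auto)
  then obtain C where C: "\<And>k. k < 16 \<Longrightarrow> C k 0 = a \<and> C k 1 = b \<and>
      (\<forall>i<16. C k i \<in> L (copy k i)) \<and> (\<forall>(i, j)\<in>set gadget_edges. C k i \<noteq> C k j)"
    by metis
  define c where "c v = C (copy_index v) (base_vertex v)" for v
  have c_copy: "c (copy k i) = C k i" if "k < 16" "i < 16" for k i
  proof (cases "i < 2")
    case True
    then have "copy_index (copy k i) = 0" by (simp add: copy_index_def copy_def)
    then show ?thesis using C[of 0] C[OF that(1)] True that less_2_cases[OF True] by (auto simp: c_def)
  next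
    case False
    then show ?thesis using that by (simp add: c_def copy_index_copy)
  qed
  have "c v \<in> L v" if "v \<in> glued_vertices" for v
    using that C c_copy unfolding glued_vertices_def by fastforce
  moreover have "proper_coloring glued_edges c"
    unfolding proper_coloring_def
  proof (intro allI impI)
    fix u v assume "{u, v} \<in> glued_edges"
    then obtain k i j where e: "k < 16" "(i, j) \<in> set gadget_edges" "{u, v} = {copy k i, copy k j}"
      by (auto simp: glued_edges_def)
    then have "c (copy k i) \<noteq> c (copy k j)"
      using C[OF e(1)] c_copy gadget_edges_lt_16[OF e(2)] by auto
    then show "c u \<noteq> c v" using e(3) by (auto simp: doubleton_eq_iff)
  qed
  ultimately show "\<exists>c. proper_coloring glued_edges c \<and> (\<forall>v\<in>glued_vertices. c v \<in> L v)" by blast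
qed

lemma not_signed_choosable_glued:
  "\<not> signed_choosable 4 glued_vertices glued_edges glued_signature"
proof
  assume ch: "signed_choosable 4 glued_vertices glued_edges glued_signature"
  \<comment> \<open>The two base-4 digits of \<open>k < 16\<close> run through all pairs from
    {1,2,3,4} and {5,6,7,8}. The terminal lists do not depend on \<open>k\<close>, so the glued
    assignment is consistent.\<close>
  define T where "T k = gadget_list (int (k div 4) + 1) (int (k mod 4) + 5)" for k
  define L where "L v = T (copy_index v) (base_vertex v)" for v
  have L_copy: "L (copy k i) = T k i" if "i < 16" for k i
  proof (cases "i < 2")
    case True
    then show ?thesis using that less_2_cases[OF True] by (auto simp: L_def T_def gadget_list_def)
  next
    case False
    then show ?thesis using that by (simp add: L_def copy_index_copy)
  qed
  have card_T: "card (T k i) = 4" if "k < 16" "i < 16" for k i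
  proof -
    have "k div 4 < 4" "k mod 4 < 4" using that by auto
    then show ?thesis unfolding T_def using that(2) by (intro card_gadget_list) auto
  qed
  have "card (L v) = 4" if "v \<in> glued_vertices" for v
    using that card_T L_copy by (auto simp: glued_vertices_def)
  then have "k_list_assignment 4 glued_vertices L"
    unfolding k_list_assignment_def list_assignment_def
    by (metis card.empty card.infinite zero_neq_numeral)
  then obtain c where c: "signed_proper_coloring glued_edges glued_signature c"
    "\<And>v. v \<in> glued_vertices \<Longrightarrow> c v \<in> L v"
    using ch unfolding signed_choosable_def by blast
  have mem: "c (copy k i) \<in> T k i" if "k < 16" "i < 16" for k i
    using c(2)[of "copy k i"] L_copy that by (auto simp: glued_vertices_def)
  have a: "c 0 \<in> {1,2,3,4}" using mem[of 0 0] by (simp add: copy_def T_def gadget_list_def)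
  have b: "c 1 \<in> {5,6,7,8}" using mem[of 0 1] by (simp add: copy_def T_def gadget_list_def)
  \<comment> \<open>Inverse of the digit encoding: the copy whose lists exclude the terminal colors
    that \<open>c\<close> actually uses.\<close>
  define k where "k = 4 * nat (c 0 - 1) + nat (c 1 - 5)"
  have k: "k < 16" "T k = gadget_list (c 0) (c 1)"
    using a b by (auto simp: k_def T_def)
  have terms: "copy k 0 = 0" "copy k 1 = 1" by (simp_all add: copy_def)
  show False
  proof (rule gadget_no_signed_coloring[of "\<lambda>i. c (copy k i)"])
    show "c (copy k 0) \<in> {1,2,3,4}" "c (copy k 1) \<in> {5,6,7,8}" using a b terms by simp_all
  next
    fix i :: nat assume "i < 16"
    then show "c (copy k i) \<in> gadget_list (c (copy k 0)) (c (copy k 1)) i"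
      using mem[OF k(1)] k(2) terms by simp
  next
    fix i j assume e: "(i, j) \<in> set gadget_edges"
    then have "{copy k i, copy k j} \<in> glued_edges" using k(1) by (auto simp: glued_edges_def)
    then show "c (copy k i) \<noteq> gadget_sign i j * c (copy k j)"
      using c(1) glued_signature_copy gadget_edges_lt_16[OF e]
      unfolding signed_proper_coloring_def by metis
  qed
qed

theorem theorem2p3:
  "\<exists>(V :: nat set) (E :: nat set set) (\<sigma> :: nat set \<Rightarrow> int).
     planar_graph V E \<and> signature E \<sigma> \<and>
     \<not> signed_choosable 4 V E \<sigma> \<and> choosable 4 V E"
proof -
  have "signature glued_edges glued_signature"
    by (simp add: signature_def glued_signature_def)
  then show ?thesis
    using planar_graph_glued not_signed_choosable_glued choosable_glued by blast
qed

end
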